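(* Let $R$ be a potent $UJ^{\#}$ ring, and put $\bar R := R/J(R)$. The following two items are true: (1) For any $\bar e=\bar e^2\in\bar R$ and any $\bar u_1,\bar u_2\in U(\bar e\bar R\bar e)$, it must be that $\bar u_1+\bar u_2\neq\bar e$. (2) There does not exist $\bar e=\bar e^2\in\bar R$ such that $\bar e\bar R\bar e\cong M_2(S)$ for some ring $S$.
   Context: All rings are associative with identity. For a ring $R$, $J(R)$ is the Jacobson radical and $U(R)$ the group of units; for an idempotent $e$, the corner ring $eRe$ has identity $e$, and $U(eRe)$ is its group of units. $M_2(S)$ is the ring of $2\times 2$ matrices over $S$. Define $J^{\#}(R)=\{z\in R : z^n\in J(R)\text{ for some } n\ge 1\}$. A ring $R$ is called a $UJ^{\#}$ ring if $U(R)=1+J^{\#}(R)$. A ring $R$ is semi-potent if every one-sided ideal not contained in $J(R)$ contains a nonzero idempotent; a semi-potent ring is potent if idempotents lift modulo $J(R)$.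
   Formalization: Item (1) is stated for nonzero idempotents ē and item (2) for nonzero rings S, since both fail literally at ē = 0: the zero corner has the unit 0 with 0 + 0 = ē, and it is isomorphic to M_2 of the zero ring. *)

theory Defs
  imports "HOL-Algebra.QuotRing"
begin

definition left_ideal :: "'a set \<Rightarrow> ('a, 'm) ring_scheme \<Rightarrow> bool" where
  "left_ideal I R \<longleftrightarrow>
     additive_subgroup I R \<and> (\<forall>a\<in>I. \<forall>x\<in>carrier R. x \<otimes>\<^bsub>R\<^esub> a \<in> I)"

definition right_ideal :: "'a set \<Rightarrow> ('a, 'm) ring_scheme \<Rightarrow> bool" where
  "right_ideal I R \<longleftrightarrow>
     additive_subgroup I R \<and> (\<forall>a\<in>I. \<forall>x\<in>carrier R. a \<otimes>\<^bsub>R\<^esub> x \<in> I)"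

definition maximal_left_ideal :: "'a set \<Rightarrow> ('a, 'm) ring_scheme \<Rightarrow> bool" where
  "maximal_left_ideal M R \<longleftrightarrow>
     left_ideal M R \<and> M \<noteq> carrier R \<and>
     (\<forall>I. left_ideal I R \<and> M \<subseteq> I \<longrightarrow> I = M \<or> I = carrier R)"

(* The intersection with the carrier matters only when there are no maximal left
   ideals, i.e. for the zero ring, where the radical is the whole ring. *)
definition jacobson_radical :: "('a, 'm) ring_scheme \<Rightarrow> 'a set" where
  "jacobson_radical R = carrier R \<inter> \<Inter>{M. maximal_left_ideal M R}"

definition jacobson_sharp :: "('a, 'm) ring_scheme \<Rightarrow> 'a set" where
  "jacobson_sharp R =
     {z \<in> carrier R. \<exists>n::nat. n \<ge> 1 \<and> z [^]\<^bsub>R\<^esub> n \<in> jacobson_radical R}"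

definition UJ_sharp_ring :: "('a, 'm) ring_scheme \<Rightarrow> bool" where
  "UJ_sharp_ring R \<longleftrightarrow>
     ring R \<and> Units R = (\<lambda>z. \<one>\<^bsub>R\<^esub> \<oplus>\<^bsub>R\<^esub> z) ` jacobson_sharp R"

definition ring_idempotents :: "('a, 'm) ring_scheme \<Rightarrow> 'a set" where
  "ring_idempotents R = {e \<in> carrier R. e \<otimes>\<^bsub>R\<^esub> e = e}"

definition semi_potent_ring :: "('a, 'm) ring_scheme \<Rightarrow> bool" where
  "semi_potent_ring R \<longleftrightarrow>
     ring R \<and>
     (\<forall>I. (left_ideal I R \<or> right_ideal I R) \<and> \<not> I \<subseteq> jacobson_radical R
        \<longrightarrow> (\<exists>e\<in>ring_idempotents R. e \<in> I \<and> e \<noteq> \<zero>\<^bsub>R\<^esub>))"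

definition idempotents_lift_modulo :: "('a, 'm) ring_scheme \<Rightarrow> 'a set \<Rightarrow> bool" where
  "idempotents_lift_modulo R I \<longleftrightarrow>
     (\<forall>a\<in>carrier R. a \<otimes>\<^bsub>R\<^esub> a \<ominus>\<^bsub>R\<^esub> a \<in> I
        \<longrightarrow> (\<exists>e\<in>ring_idempotents R. e \<ominus>\<^bsub>R\<^esub> a \<in> I))"

definition potent_ring :: "('a, 'm) ring_scheme \<Rightarrow> bool" where
  "potent_ring R \<longleftrightarrow>
     semi_potent_ring R \<and> idempotents_lift_modulo R (jacobson_radical R)"

definition corner_ring :: "('a, 'm) ring_scheme \<Rightarrow> 'a \<Rightarrow> ('a, 'm) ring_scheme" where
  "corner_ring R e =
     R\<lparr>carrier := (\<lambda>x. e \<otimes>\<^bsub>R\<^esub> x \<otimes>\<^bsub>R\<^esub> e) ` carrier R, one := e\<rparr>"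

(* Matrices are functions on the index pairs, restricted to {..<n} x {..<n}
   (and hence undefined outside) so that equality is entrywise. *)
definition matrix_ring :: "nat \<Rightarrow> ('b, 'n) ring_scheme \<Rightarrow> (nat \<times> nat \<Rightarrow> 'b) ring" where
  "matrix_ring n S =
     \<lparr>carrier = ({..<n} \<times> {..<n}) \<rightarrow>\<^sub>E carrier S,
      mult = (\<lambda>A B. \<lambda>(i, j)\<in>{..<n} \<times> {..<n}. \<Oplus>\<^bsub>S\<^esub>k\<in>{..<n}. A (i, k) \<otimes>\<^bsub>S\<^esub> B (k, j)),
      one = (\<lambda>(i, j)\<in>{..<n} \<times> {..<n}. if i = j then \<one>\<^bsub>S\<^esub> else \<zero>\<^bsub>S\<^esub>),
      zero = (\<lambda>(i, j)\<in>{..<n} \<times> {..<n}. \<zero>\<^bsub>S\<^esub>),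
      add = (\<lambda>A B. \<lambda>(i, j)\<in>{..<n} \<times> {..<n}. A (i, j) \<oplus>\<^bsub>S\<^esub> B (i, j))\<rparr>"

abbreviation jacobson_quotient :: "('a, 'm) ring_scheme \<Rightarrow> 'a set ring" where
  "jacobson_quotient R \<equiv> R Quot (jacobson_radical R)"

end

theory Submission
  imports Defs
begin

text \<open>
  Since \<open>1 + J(R)\<close> consists of units, units lift modulo \<open>J(R)\<close>, so every unit of \<open>R/J(R)\<close> is
  \<open>1\<close> plus a nilpotent element. If \<open>u\<^sub>1 + u\<^sub>2 = e\<close> with \<open>u\<^sub>1, u\<^sub>2\<close> units of the corner at \<open>e\<close>, then
  \<open>u\<^sub>1 + (1 - e)\<close> is a unit of the whole ring, and it differs from \<open>1\<close> by \<open>u\<^sub>1 - e = -u\<^sub>2\<close>. Hence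
  \<open>u\<^sub>2\<close> is a nilpotent unit of the corner and \<open>e = 0\<close>. The second item reduces to the first because the
  identity of \<open>M\<^sub>2(S)\<close> is a sum of two units:
  \<open>I = [[1, 1], [1, 0]] + [[0, -1], [-1, 1]]\<close>.
\<close>

section \<open>Left ideals and the Jacobson radical\<close>

context ring
begin

lemma add_minus_cancel:
  assumes "a \<in> carrier R" "b \<in> carrier R"
  shows "a \<oplus> (b \<ominus> a) = b"
  using assms by (metis a_inv_closed a_lcomm minus_eq r_neg r_zero)

text \<open>Closure under negation comes for free from absorption, because -a = (-1)a.\<close>

lemma left_idealI:
  assumes "I \<subseteq> carrier R" "\<zero> \<in> I" "\<And>a b. a \<in> I \<Longrightarrow> b \<in> I \<Longrightarrow> a \<oplus> b \<in> I"
    and smult: "\<And>a x. a \<in> I \<Longrightarrow> x \<in> carrier R \<Longrightarrow> x \<otimes> a \<in> I"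
  shows "left_ideal I R"
proof -
  have "\<ominus> a \<in> I" if "a \<in> I" for a
  proof -
    have "\<ominus> a = (\<ominus> \<one>) \<otimes> a" using that assms(1) by (simp add: l_minus subsetD)
    then show ?thesis using smult[OF that, of "\<ominus> \<one>"] by simp
  qed
  then have "additive_subgroup I R"
    using assms by (intro additive_subgroup.intro add.subgroupI) (auto simp: a_inv_def)
  then show ?thesis using smult unfolding left_ideal_def by blast
qed

lemma left_idealD:
  assumes "left_ideal I R"
  shows "I \<subseteq> carrier R" "\<zero> \<in> I" "a \<in> I \<Longrightarrow> b \<in> I \<Longrightarrow> a \<oplus> b \<in> I" "a \<in> I \<Longrightarrow> \<ominus> a \<in> I"
    "a \<in> I \<Longrightarrow> x \<in> carrier R \<Longrightarrow> x \<otimes> a \<in> I"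
  using assms unfolding left_ideal_def
  by (auto simp: additive_subgroup.a_subset additive_subgroup.zero_closed
      additive_subgroup.a_closed additive_subgroup.a_inv_closed
      dest: additive_subgroup.a_Hcarr)

lemma left_ideal_eq_carrier:
  assumes "left_ideal I R" "\<one> \<in> I"
  shows "I = carrier R"
  using left_idealD(1)[OF assms(1)] left_idealD(5)[OF assms] by force

text \<open>Zorn's lemma on the left ideals that contain \<open>L\<close> and avoid
  \<open>\<one>\<close>. A left ideal is proper exactly when it misses \<open>\<one>\<close>, and in
  this form properness visibly survives unions of chains.\<close>

lemma maximal_left_ideal_exists:
  assumes L: "left_ideal L R" and "\<one> \<notin> L"
  obtains M where "maximal_left_ideal M R" "L \<subseteq> M"
proof -
  define A where "A = {I. left_ideal I R \<and> L \<subseteq> I \<and> \<one> \<notin> I}"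
  have "\<exists>M\<in>A. \<forall>X\<in>A. M \<subseteq> X \<longrightarrow> X = M"
  proof (rule subset_Zorn_nonempty)
    show "A \<noteq> {}" using assms by (auto simp: A_def)
    fix C assume C: "C \<noteq> {}" "subset.chain A C"
    then have CA: "\<And>I. I \<in> C \<Longrightarrow> I \<in> A" and tot: "\<And>I K. I \<in> C \<Longrightarrow> K \<in> C \<Longrightarrow> I \<subseteq> K \<or> K \<subseteq> I"
      by (auto simp: subset.chain_def subset_chain_def)
    have CL: "\<And>I. I \<in> C \<Longrightarrow> left_ideal I R" using CA by (simp add: A_def)
    have "left_ideal (\<Union>C) R"
    proof (rule left_idealI)
      show "\<Union>C \<subseteq> carrier R" using left_idealD(1)[OF CL] by blast
      show "\<zero> \<in> \<Union>C" using C(1) left_idealD(2)[OF CL] by blast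
      show "a \<oplus> b \<in> \<Union>C" if ab: "a \<in> \<Union>C" "b \<in> \<Union>C" for a b
      proof -
        obtain I K where IK: "I \<in> C" "K \<in> C" "a \<in> I" "b \<in> K" using ab by blast
        then obtain N where "N \<in> C" "a \<in> N" "b \<in> N" using tot[OF IK(1,2)] by blast
        then show ?thesis using left_idealD(3)[OF CL] by blast
      qed
      show "x \<otimes> a \<in> \<Union>C" if "a \<in> \<Union>C" "x \<in> carrier R" for a x
        using that left_idealD(5)[OF CL] by blast
    qed
    then show "\<Union>C \<in> A" using C(1) CA by (auto simp: A_def)
  qed
  then obtain M where M: "M \<in> A" and max: "\<And>X. X \<in> A \<Longrightarrow> M \<subseteq> X \<Longrightarrow> X = M" by blast
  have "maximal_left_ideal M R"
    unfolding maximal_left_ideal_def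
  proof (intro conjI allI impI)
    show "left_ideal M R" "M \<noteq> carrier R" using M by (auto simp: A_def)
    fix I assume I: "left_ideal I R \<and> M \<subseteq> I"
    show "I = M \<or> I = carrier R"
    proof (cases "\<one> \<in> I")
      case True
      then show ?thesis using I left_ideal_eq_carrier by blast
    next
      case False
      then have "I \<in> A" using I M by (auto simp: A_def)
      then show ?thesis using I max by blast
    qed
  qed
  then show thesis using that M by (auto simp: A_def)
qed

text \<open>Conceptually, this set is the kernel of the left module map x \<mapsto> xr + M from R to
  the simple module R/M. The map is nonzero because \<open>r\<close> lies outside \<open>M\<close>,
  hence surjective, so its kernel is maximal. The proof below unwinds this into elements. The lemma
  is what makes a radical built from left ideals absorb factors on the right.\<close>

lemma maximal_left_ideal_colon:
  assumes M: "maximal_left_ideal M R" and r: "r \<in> carrier R" "r \<notin> M"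
  shows "maximal_left_ideal {x \<in> carrier R. x \<otimes> r \<in> M} R"
proof -
  let ?N = "{x \<in> carrier R. x \<otimes> r \<in> M}"
  have maxl: "left_ideal M R" using M by (simp add: maximal_left_ideal_def)
  note maxl' = left_idealD[OF maxl]
  show ?thesis
    unfolding maximal_left_ideal_def
  proof (intro conjI allI impI)
    show "left_ideal ?N R"
      by (rule left_idealI) (use r maxl' in \<open>auto simp: l_distr m_assoc\<close>)
    show "?N \<noteq> carrier R" using r one_closed l_one by (metis (mono_tags, lifting) mem_Collect_eq)
    fix I assume I: "left_ideal I R \<and> ?N \<subseteq> I"
    note I' = left_idealD[OF conjunct1[OF I]]
    show "I = ?N \<or> I = carrier R"
    proof (cases "I \<subseteq> ?N")
      case True
      then show ?thesis using I by blast
    next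
      case False
      then obtain i0 where i0: "i0 \<in> I" "i0 \<in> carrier R" "i0 \<otimes> r \<notin> M" using I'(1) by blast
      \<comment> \<open>\<open>K\<close> is Ir + M. It contains \<open>i0 \<otimes> r\<close>, which
        is not in \<open>M\<close>, so maximality of \<open>M\<close> forces it to be the whole
        ring, and in particular to contain \<open>r\<close>.\<close>
      define K where "K = {i \<otimes> r \<oplus> m |i m. i \<in> I \<and> m \<in> M}"
      have KL: "left_ideal K R"
      proof (rule left_idealI)
        show "K \<subseteq> carrier R" using r I'(1) maxl'(1) by (auto simp: K_def)
        have "\<zero> = \<zero> \<otimes> r \<oplus> \<zero>" using r by simp
        then show "\<zero> \<in> K" using I'(2) maxl'(2) unfolding K_def by blast
      next
        fix a b assume "a \<in> K" "b \<in> K"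
        then obtain i m i' m' where im: "i \<in> I" "m \<in> M" "i' \<in> I" "m' \<in> M"
          and ab: "a = i \<otimes> r \<oplus> m" "b = i' \<otimes> r \<oplus> m'" by (auto simp: K_def)
        have car: "i \<in> carrier R" "m \<in> carrier R" "i' \<in> carrier R" "m' \<in> carrier R"
          using im I'(1) maxl'(1) by auto
        have "a \<oplus> b = (i \<oplus> i') \<otimes> r \<oplus> (m \<oplus> m')"
          using car r by (simp add: ab l_distr a_ac)
        then show "a \<oplus> b \<in> K" using im I'(3) maxl'(3) unfolding K_def by blast
      next
        fix a x assume "a \<in> K" and x: "x \<in> carrier R"
        then obtain i m where im: "i \<in> I" "m \<in> M" and a: "a = i \<otimes> r \<oplus> m" by (auto simp: K_def)
        have car: "i \<in> carrier R" "m \<in> carrier R" using im I'(1) maxl'(1) by auto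
        have "x \<otimes> a = (x \<otimes> i) \<otimes> r \<oplus> (x \<otimes> m)" using car r x by (simp add: a r_distr m_assoc)
        then show "x \<otimes> a \<in> K" using im x I'(5) maxl'(5) unfolding K_def by blast
      qed
      have "M \<subseteq> K"
      proof
        fix m assume m: "m \<in> M"
        then have "m = \<zero> \<otimes> r \<oplus> m" using r maxl'(1) by auto
        then show "m \<in> K" using m I'(2) unfolding K_def by blast
      qed
      moreover have "i0 \<otimes> r \<in> K"
      proof -
        have "i0 \<otimes> r = i0 \<otimes> r \<oplus> \<zero>" using i0 r by simp
        then show ?thesis using i0 maxl'(2) unfolding K_def by blast
      qed
      ultimately have "K = carrier R" using M KL i0 unfolding maximal_left_ideal_def by blast
      then obtain i m where im: "i \<in> I" "m \<in> M" and eq: "r = i \<otimes> r \<oplus> m"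
        using r(1) unfolding K_def by blast
      have car: "i \<in> carrier R" "m \<in> carrier R" using im I'(1) maxl'(1) by auto
      \<comment> \<open>From r = ir + m one gets (1 - i)r = m in \<open>M\<close>, so 1 - i lies in
        \<open>?N\<close> and therefore in \<open>I\<close>. Adding \<open>i\<close> puts
        \<open>\<one>\<close> in \<open>I\<close>.\<close>
      have "(\<one> \<oplus> \<ominus> i) \<otimes> r = r \<oplus> \<ominus> (i \<otimes> r)" using car r by (simp add: l_distr l_minus)
      also have "\<dots> = (i \<otimes> r \<oplus> m) \<oplus> \<ominus> (i \<otimes> r)" using eq by simp
      also have "\<dots> = m" using car r by (metis a_comm m_closed r_neg1 a_closed a_inv_closed r_neg2)
      finally have "\<one> \<oplus> \<ominus> i \<in> I" using im car I by auto
      then have "(\<one> \<oplus> \<ominus> i) \<oplus> i \<in> I" using im I'(3) by blast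
      moreover have "(\<one> \<oplus> \<ominus> i) \<oplus> i = \<one>" using car by (simp add: a_assoc l_neg)
      ultimately show ?thesis using I left_ideal_eq_carrier by simp
    qed
  qed
qed

section \<open>The radical as a two-sided ideal, and the units in 1 + J(R)\<close>

lemma left_ideal_jacobson_radical: "left_ideal (jacobson_radical R) R"
proof (rule left_idealI)
  have maxl: "left_ideal M R" if "maximal_left_ideal M R" for M
    using that by (simp add: maximal_left_ideal_def)
  note M' = left_idealD[OF maxl]
  show "jacobson_radical R \<subseteq> carrier R" by (auto simp: jacobson_radical_def)
  show "\<zero> \<in> jacobson_radical R" using M'(2) by (auto simp: jacobson_radical_def)
  show "a \<oplus> b \<in> jacobson_radical R" if "a \<in> jacobson_radical R" "b \<in> jacobson_radical R" for a b
    using that M'(3) by (auto simp: jacobson_radical_def)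
  show "x \<otimes> a \<in> jacobson_radical R" if "a \<in> jacobson_radical R" "x \<in> carrier R" for a x
    using that M'(5) by (auto simp: jacobson_radical_def)
qed

text \<open>Only absorption on the right needs an argument. Fix a maximal left ideal
  \<open>M\<close>: if \<open>x\<close> is in \<open>M\<close>, so is ax; otherwise the elements
  that \<open>x\<close> multiplies into \<open>M\<close> form a maximal left ideal, which contains
  \<open>a\<close>.\<close>

lemma ideal_jacobson_radical: "ideal (jacobson_radical R) R"
proof (rule idealI)
  note J' = left_idealD[OF left_ideal_jacobson_radical]
  show "ring R" by (rule ring_axioms)
  show "subgroup (jacobson_radical R) (add_monoid R)"
    using left_ideal_jacobson_radical by (simp add: left_ideal_def additive_subgroup.a_subgroup)
  fix a x assume a: "a \<in> jacobson_radical R" and x: "x \<in> carrier R"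
  show "x \<otimes> a \<in> jacobson_radical R" using a x J'(5) by blast
  have ac: "a \<in> carrier R" using a J'(1) by blast
  have "a \<otimes> x \<in> M" if M: "maximal_left_ideal M R" for M
  proof (cases "x \<in> M")
    case True
    then show ?thesis using M left_idealD(5) ac by (auto simp: maximal_left_ideal_def)
  next
    case False
    from maximal_left_ideal_colon[OF M x False] have "a \<in> {y \<in> carrier R. y \<otimes> x \<in> M}"
      using a unfolding jacobson_radical_def by blast
    then show ?thesis by simp
  qed
  then show "a \<otimes> x \<in> jacobson_radical R" using ac x by (auto simp: jacobson_radical_def)
qed

text \<open>If the left ideal R(1 + j) were proper, it would sit inside a maximal left ideal, which
  also contains \<open>j\<close> and hence 1.\<close>

lemma left_inverse_one_plus_radical:
  assumes j: "j \<in> jacobson_radical R"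
  obtains a where "a \<in> carrier R" "a \<otimes> (\<one> \<oplus> j) = \<one>"
proof -
  have jc: "j \<in> carrier R" using j by (simp add: jacobson_radical_def)
  define L where "L = {a \<otimes> (\<one> \<oplus> j) |a. a \<in> carrier R}"
  have memL: "a \<otimes> (\<one> \<oplus> j) \<in> L" if "a \<in> carrier R" for a using that by (auto simp: L_def)
  have LL: "left_ideal L R"
  proof (rule left_idealI)
    show "L \<subseteq> carrier R" using jc by (auto simp: L_def)
    show "\<zero> \<in> L" using memL[of \<zero>] jc by simp
    show "a \<oplus> b \<in> L" if ab: "a \<in> L" "b \<in> L" for a b
    proof -
      from ab obtain a' b' where "a' \<in> carrier R" "b' \<in> carrier R"
        "a = a' \<otimes> (\<one> \<oplus> j)" "b = b' \<otimes> (\<one> \<oplus> j)" by (auto simp: L_def)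
      then show ?thesis using memL[of "a' \<oplus> b'"] jc by (simp add: l_distr)
    qed
    show "x \<otimes> a \<in> L" if ax: "a \<in> L" "x \<in> carrier R" for a x
    proof -
      from ax obtain a' where "a' \<in> carrier R" "a = a' \<otimes> (\<one> \<oplus> j)" by (auto simp: L_def)
      then show ?thesis using memL[of "x \<otimes> a'"] ax jc by (simp add: m_assoc)
    qed
  qed
  have "\<one> \<in> L"
  proof (rule ccontr)
    assume "\<one> \<notin> L"
    then obtain M where M: "maximal_left_ideal M R" "L \<subseteq> M"
      using maximal_left_ideal_exists[OF LL] by blast
    then have maxl: "left_ideal M R" by (simp add: maximal_left_ideal_def)
    have "j \<in> M" using j M by (auto simp: jacobson_radical_def)
    moreover have "\<one> \<oplus> j \<in> M" using memL[of \<one>] M jc by auto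
    ultimately have "(\<one> \<oplus> j) \<oplus> \<ominus> j \<in> M" using left_idealD[OF maxl] by blast
    then have "\<one> \<in> M" using jc by (simp add: a_assoc r_neg)
    then show False using left_ideal_eq_carrier[OF maxl] M by (simp add: maximal_left_ideal_def)
  qed
  then show thesis using that by (auto simp: L_def)
qed

text \<open>The left inverse a = 1 - aj again has the form 1 plus a radical element, so it has a
  left inverse \<open>b\<close> of its own. An element with both a left and a right inverse has them
  equal, so b = 1 + j and \<open>a\<close> is a two-sided inverse.\<close>

lemma one_plus_radical_Units:
  assumes j: "j \<in> jacobson_radical R"
  shows "\<one> \<oplus> j \<in> Units R"
proof -
  note J' = left_idealD[OF left_ideal_jacobson_radical]
  have jc: "j \<in> carrier R" using j J'(1) by blast
  obtain a where a: "a \<in> carrier R" "a \<otimes> (\<one> \<oplus> j) = \<one>"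
    using left_inverse_one_plus_radical[OF j] by blast
  have "a \<oplus> a \<otimes> j = \<one>" using a jc by (simp add: r_distr)
  then have aeq: "a = \<one> \<oplus> \<ominus> (a \<otimes> j)" using a jc by (metis a_assoc a_inv_closed m_closed r_neg r_zero)
  have "\<ominus> (a \<otimes> j) \<in> jacobson_radical R" using j a J' by blast
  from left_inverse_one_plus_radical[OF this] obtain b where b: "b \<in> carrier R" "b \<otimes> a = \<one>"
    using aeq by auto
  have "b = \<one> \<oplus> j"
    using a b jc by (metis a_closed m_assoc l_one r_one one_closed)
  then show ?thesis using a b jc unfolding Units_def by blast
qed

end

section \<open>Units of the quotient by the radical\<close>

lemma (in ring) Units_jacobson_quotient_lift:
  assumes U: "U \<in> Units (jacobson_quotient R)"
  obtains x where "x \<in> Units R" "U = jacobson_radical R +> x"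
proof -
  let ?J = "jacobson_radical R"
  interpret J: ideal ?J R by (rule ideal_jacobson_radical)
  interpret h: ring_hom_ring R "R Quot ?J" "(+>) ?J" by (rule J.rcos_ring_hom_ring)
  obtain V where V: "V \<in> carrier (R Quot ?J)" "U \<in> carrier (R Quot ?J)"
    "V \<otimes>\<^bsub>R Quot ?J\<^esub> U = \<one>\<^bsub>R Quot ?J\<^esub>" "U \<otimes>\<^bsub>R Quot ?J\<^esub> V = \<one>\<^bsub>R Quot ?J\<^esub>"
    using U by (auto simp: Units_def)
  have rep: "\<exists>w \<in> carrier R. W = ?J +> w" if "W \<in> carrier (R Quot ?J)" for W
    using that unfolding FactRing_def A_RCOSETS_def' by simp
  obtain x where x: "x \<in> carrier R" "U = ?J +> x" using rep[OF V(2)] by blast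
  obtain y where y: "y \<in> carrier R" "V = ?J +> y" using rep[OF V(1)] by blast
  \<comment> \<open>The preimage of 1 in the quotient is 1 + J(R), which consists of units. This
    applies to both xy and yx.\<close>
  have unit: "a \<in> Units R" if a: "a \<in> carrier R" "?J +> a = \<one>\<^bsub>R Quot ?J\<^esub>" for a
  proof -
    have "?J +> a = ?J +> \<one>" using a(2) h.hom_one by metis
    then have "a \<ominus> \<one> \<in> ?J" 
      using a by (simp add: quotient_eq_iff_same_a_r_cos[OF J.ideal_axioms])
    then have "\<one> \<oplus> (a \<ominus> \<one>) \<in> Units R" by (rule one_plus_radical_Units)
    moreover have "\<one> \<oplus> (a \<ominus> \<one>) = a" using a by (simp add: add_minus_cancel)
    ultimately show ?thesis by simp
  qed
  have "x \<otimes> y \<in> Units R" "y \<otimes> x \<in> Units R"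
    using V(3,4) x y by (auto intro!: unit simp: h.hom_mult)
  then obtain a b where a: "a \<in> carrier R" "(x \<otimes> y) \<otimes> a = \<one>"
    and b: "b \<in> carrier R" "b \<otimes> (y \<otimes> x) = \<one>"
    by (meson Units_inv_closed Units_l_inv Units_r_inv)
  \<comment> \<open>The inverses of xy and yx give \<open>x\<close> a right inverse and a left
    inverse, which must then coincide.\<close>
  have "x \<otimes> (y \<otimes> a) = \<one>" "(b \<otimes> y) \<otimes> x = \<one>" using a b x y by (simp_all add: m_assoc)
  moreover from this have "b \<otimes> y = y \<otimes> a"
    using inv_unique[of "b \<otimes> y" x "y \<otimes> a"] a b x y by simp
  ultimately have "x \<in> Units R" using a x y unfolding Units_def by auto
  then show thesis using that x by blast
qed

text \<open>A unit of the quotient lifts to a unit 1 + z of \<open>R\<close> with some power of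
  \<open>z\<close> in the radical, and that power vanishes in the quotient.\<close>

lemma (in ring) UJ_sharp_quotient_Units:
  assumes "UJ_sharp_ring R" and U: "U \<in> Units (jacobson_quotient R)"
  shows "\<exists>z \<in> carrier (jacobson_quotient R). \<exists>n\<ge>1::nat.
    U = \<one>\<^bsub>jacobson_quotient R\<^esub> \<oplus>\<^bsub>jacobson_quotient R\<^esub> z \<and>
    z [^]\<^bsub>jacobson_quotient R\<^esub> n = \<zero>\<^bsub>jacobson_quotient R\<^esub>"
proof -
  let ?J = "jacobson_radical R"
  interpret J: ideal ?J R by (rule ideal_jacobson_radical)
  interpret h: ring_hom_ring R "R Quot ?J" "(+>) ?J" by (rule J.rcos_ring_hom_ring)
  obtain x where x: "x \<in> Units R" "U = ?J +> x" using Units_jacobson_quotient_lift[OF U] by blast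
  then obtain z where z: "z \<in> jacobson_sharp R" "x = \<one> \<oplus> z"
    using assms by (auto simp: UJ_sharp_ring_def)
  then obtain n :: nat where n: "n \<ge> 1" "z [^] n \<in> ?J" "z \<in> carrier R" by (auto simp: jacobson_sharp_def)
  have "(?J +> z) [^]\<^bsub>R Quot ?J\<^esub> n = ?J +> (z [^] n)" using n by (simp add: h.hom_nat_pow)
  also have "\<dots> = \<zero>\<^bsub>R Quot ?J\<^esub>"
    unfolding J.a_rcos_const[OF n(2)] by (simp only: FactRing_def ring.simps)
  finally have "(?J +> z) [^]\<^bsub>R Quot ?J\<^esub> n = \<zero>\<^bsub>R Quot ?J\<^esub>" .
  moreover have "U = \<one>\<^bsub>R Quot ?J\<^esub> \<oplus>\<^bsub>R Quot ?J\<^esub> (?J +> z)"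
    using h.hom_add[OF one_closed n(3)] h.hom_one x(2) z(2) by simp
  ultimately show ?thesis using n(1) h.hom_closed[OF n(3)] by blast
qed

section \<open>Units of corner rings\<close>

lemma (in ring) corner_ring_carrierD:
  assumes "e \<in> ring_idempotents R" "x \<in> carrier (corner_ring R e)"
  shows "x \<in> carrier R" "e \<otimes> x = x" "x \<otimes> e = x"
proof -
  obtain y where e: "e \<in> carrier R" "e \<otimes> e = e" and y: "y \<in> carrier R" "x = e \<otimes> y \<otimes> e"
    using assms by (auto simp: ring_idempotents_def corner_ring_def)
  then show "x \<in> carrier R" by simp
  show "x \<otimes> e = x" using e y by (simp add: m_assoc)
  show "e \<otimes> x = x" using e y by (metis m_assoc m_closed)
qed

lemma (in ring) corner_ring_carrierI:
  assumes "x \<in> carrier R" "e \<otimes> x = x" "x \<otimes> e = x"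
  shows "x \<in> carrier (corner_ring R e)"
  using assms by (auto simp: corner_ring_def image_iff intro!: bexI[of _ x])

lemma corner_ring_simps [simp]:
  "mult (corner_ring R e) = mult R" "one (corner_ring R e) = e" "add (corner_ring R e) = add R"
  by (simp_all add: corner_ring_def)

text \<open>The inverse is v + (1 - e), where \<open>v\<close> is the inverse of \<open>u\<close> in
  the corner: the corners at e and 1 - e annihilate each other, so the two summands multiply
  independently.\<close>

lemma (in ring) corner_unit_extends:
  assumes e: "e \<in> ring_idempotents R" and u: "u \<in> Units (corner_ring R e)"
  shows "u \<oplus> (\<one> \<ominus> e) \<in> Units R"
proof -
  obtain v where uv: "u \<in> carrier (corner_ring R e)" "v \<in> carrier (corner_ring R e)"
    "v \<otimes> u = e" "u \<otimes> v = e" using u by (auto simp: Units_def)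
  note u' = corner_ring_carrierD[OF e uv(1)] and v' = corner_ring_carrierD[OF e uv(2)]
  have ec: "e \<in> carrier R" "e \<otimes> e = e" using e by (auto simp: ring_idempotents_def)
  define f where "f = \<one> \<ominus> e"
  have fc: "f \<in> carrier R" using ec by (simp add: f_def)
  have xf: "x \<otimes> f = \<zero>" if "x \<in> carrier R" "x \<otimes> e = x" for x
    using that ec by (simp add: f_def minus_eq r_distr r_minus r_neg)
  have fx: "f \<otimes> x = \<zero>" if "x \<in> carrier R" "e \<otimes> x = x" for x
    using that ec by (simp add: f_def minus_eq l_distr l_minus r_neg)
  have "f \<otimes> f = (\<one> \<oplus> \<ominus> e) \<otimes> f" by (simp add: f_def minus_eq)
  also have "\<dots> = f" using ec fc xf[of e] by (simp add: l_distr l_minus)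
  finally have ff: "f \<otimes> f = f" .
  have ef: "e \<oplus> f = \<one>" using ec by (simp add: f_def add_minus_cancel)
  \<comment> \<open>The cross terms xf and fy vanish, leaving e + f = 1. Stated for general
    \<open>x\<close> and \<open>y\<close> so that it covers both orders of \<open>u\<close> and
    \<open>v\<close>.\<close>
  have "(x \<oplus> f) \<otimes> (y \<oplus> f) = \<one>"
    if "x \<in> carrier R" "y \<in> carrier R" "x \<otimes> y = e" "x \<otimes> e = x" "e \<otimes> y = y" for x y
    using that ec fc xf[of x] fx[of y] ff ef by (simp add: l_distr r_distr)
  then have "(u \<oplus> f) \<otimes> (v \<oplus> f) = \<one>" "(v \<oplus> f) \<otimes> (u \<oplus> f) = \<one>" using u' v' uv by auto
  then show ?thesis using u' v' fc unfolding Units_def f_def[symmetric] by blast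
qed

text \<open>Phrased for any ring whose units are all 1 plus a nilpotent; the quotient by the radical
  is the intended instance.\<close>

lemma (in ring) corner_Units_sum_idempotent:
  assumes nil: "\<And>U. U \<in> Units R \<Longrightarrow> \<exists>z \<in> carrier R. \<exists>n\<ge>1::nat. U = \<one> \<oplus> z \<and> z [^] n = \<zero>"
    and e: "e \<in> ring_idempotents R"
    and u1: "u1 \<in> Units (corner_ring R e)" and u2: "u2 \<in> Units (corner_ring R e)"
    and sum: "u1 \<oplus> u2 = e"
  shows "e = \<zero>"
proof -
  have ec: "e \<in> carrier R" "e \<otimes> e = e" using e by (auto simp: ring_idempotents_def)
  obtain v where uv: "u2 \<in> carrier (corner_ring R e)" "v \<in> carrier (corner_ring R e)"
    "u2 \<otimes> v = e" using u2 by (auto simp: Units_def)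
  note u' = corner_ring_carrierD[OF e uv(1)] and v' = corner_ring_carrierD[OF e uv(2)]
  have u1c: "u1 \<in> carrier R" using u1 corner_ring_carrierD(1)[OF e] by (auto simp: Units_def)
  obtain z and n :: nat where z: "z \<in> carrier R" "n \<ge> 1" "u1 \<oplus> (\<one> \<ominus> e) = \<one> \<oplus> z" "z [^] n = \<zero>"
    using nil[OF corner_unit_extends[OF e u1]] by blast
  have "\<one> \<oplus> z = \<one> \<oplus> (u1 \<ominus> e)" using z(3) u1c ec by (simp add: minus_eq a_lcomm)
  then have "z = u1 \<ominus> e" using z(1) u1c ec by (metis minus_closed one_closed r_neg1)
  also have "\<dots> = \<ominus> u2"
    using u1c u' by (simp add: sum[symmetric] minus_eq minus_add r_neg2 a_lcomm r_neg)
  finally have zu: "z = \<ominus> u2" .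
  \<comment> \<open>As z = -u2, the negative of \<open>v\<close> inverts \<open>z\<close> in the
    corner.\<close>
  define c where "c = \<ominus> v"
  have c: "c \<in> carrier R" "e \<otimes> c = c" "z \<otimes> c = e"
    using v' u' ec uv(3) by (simp_all add: c_def zu r_minus l_minus)
  \<comment> \<open>Cancelling the innermost factor zc to \<open>e\<close>, which the remaining
    power of \<open>c\<close> absorbs, lowers the exponent. The exponents start at 1 because powers
    are taken in the whole ring, where the zeroth power is \<open>\<one>\<close> rather than
    \<open>e\<close>.\<close>
  have "z [^] Suc m \<otimes> c [^] Suc m = e" for m
  proof (induction m)
    case 0
    then show ?case using c z by simp
  next
    case (Suc m)
    have ecm: "e \<otimes> c [^] Suc m = c [^] Suc m"
      using c ec by (metis m_assoc nat_pow_Suc2 nat_pow_closed)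
    have "z [^] Suc (Suc m) \<otimes> c [^] Suc (Suc m) = (z [^] Suc m \<otimes> z) \<otimes> (c \<otimes> c [^] Suc m)"
      using c(1) nat_pow_Suc2[OF c(1), of "Suc m"] by simp
    also have "\<dots> = z [^] Suc m \<otimes> ((z \<otimes> c) \<otimes> c [^] Suc m)"
      using c z by (metis m_assoc m_closed nat_pow_closed)
    also have "\<dots> = e" using c ecm Suc by simp
    finally show ?case .
  qed
  \<comment> \<open>Since n \<ge> 1, the exponent here is \<open>n\<close> itself, so the product is
    zero as well as \<open>e\<close>.\<close>
  from this[of "n - 1"] show ?thesis using z c by simp
qed

section \<open>Two-by-two matrices\<close>

text \<open>Entries are listed row by row. The restriction to the index square matches the
  extensional functions that make up \<open>matrix_ring\<close>, so matrix identities become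
  equalities of \<open>mat2\<close> terms.\<close>

definition mat2 :: "'b \<Rightarrow> 'b \<Rightarrow> 'b \<Rightarrow> 'b \<Rightarrow> nat \<times> nat \<Rightarrow> 'b" where
  "mat2 a b c d = (\<lambda>(i, j)\<in>{..<2} \<times> {..<2}.
     if i = 0 then (if j = 0 then a else b) else (if j = 0 then c else d))"

lemma less_two_cases: "(i::nat) < 2 \<longleftrightarrow> i = 0 \<or> i = 1"
  by auto

lemma lessThan_two: "{..<2::nat} = {0, 1}"
  by auto

lemma mat2_apply [simp]:
  "mat2 a b c d (0, 0) = a" "mat2 a b c d (0, Suc 0) = b"
  "mat2 a b c d (Suc 0, 0) = c" "mat2 a b c d (Suc 0, Suc 0) = d"
  by (simp_all add: mat2_def)

lemma mat2_eqI:
  assumes "\<And>i j. \<not> (i < 2 \<and> j < 2) \<Longrightarrow> A (i, j) = undefined"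
    and "A (0, 0) = a" "A (0, 1) = b" "A (1, 0) = c" "A (1, 1) = d"
  shows "A = mat2 a b c d"
proof
  fix p :: "nat \<times> nat"
  obtain i j where p: "p = (i, j)" by (cases p)
  show "A p = mat2 a b c d p"
  proof (cases "i < 2 \<and> j < 2")
    case True
    then show ?thesis using assms(2-) by (auto simp: p less_two_cases)
  next
    case False
    then show ?thesis using assms(1)[of i j] by (auto simp: p mat2_def)
  qed
qed

context ring
begin

lemma mat2_carrier:
  assumes "a \<in> carrier R" "b \<in> carrier R" "c \<in> carrier R" "d \<in> carrier R"
  shows "mat2 a b c d \<in> carrier (matrix_ring 2 R)"
  using assms by (auto simp: matrix_ring_def mat2_def PiE_iff)

lemma mat2_one: "\<one>\<^bsub>matrix_ring 2 R\<^esub> = mat2 \<one> \<zero> \<zero> \<one>"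
  by (rule mat2_eqI) (auto simp: matrix_ring_def)

lemma mat2_add:
  "mat2 a b c d \<oplus>\<^bsub>matrix_ring 2 R\<^esub> mat2 a' b' c' d' =
     mat2 (a \<oplus> a') (b \<oplus> b') (c \<oplus> c') (d \<oplus> d')"
  by (rule mat2_eqI) (auto simp: matrix_ring_def)

lemma mat2_mult:
  assumes "a \<in> carrier R" "b \<in> carrier R" "c \<in> carrier R" "d \<in> carrier R"
    "a' \<in> carrier R" "b' \<in> carrier R" "c' \<in> carrier R" "d' \<in> carrier R"
  shows "mat2 a b c d \<otimes>\<^bsub>matrix_ring 2 R\<^esub> mat2 a' b' c' d' =
     mat2 (a \<otimes> a' \<oplus> b \<otimes> c') (a \<otimes> b' \<oplus> b \<otimes> d') (c \<otimes> a' \<oplus> d \<otimes> c') (c \<otimes> b' \<oplus> d \<otimes> d')"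
  by (rule mat2_eqI) (use assms in \<open>auto simp: matrix_ring_def lessThan_two\<close>)

text \<open>The matrix A = [[1, 1], [1, 0]] satisfies A^2 = A + I, so A - I is its inverse. Hence B
  = I - A is the negative of that inverse, and is itself inverted by -A. All entries are 0, 1 or -1,
  so this works over every ring, commutative or not.\<close>

lemma matrix_ring_2_one_sum_of_Units:
  obtains A B where "A \<in> Units (matrix_ring 2 R)" "B \<in> Units (matrix_ring 2 R)"
    "A \<oplus>\<^bsub>matrix_ring 2 R\<^esub> B = \<one>\<^bsub>matrix_ring 2 R\<^esub>"
proof
  let ?M = "matrix_ring 2 R" and ?A = "mat2 \<one> \<one> \<one> \<zero>" and ?A' = "mat2 \<zero> \<one> \<one> (\<ominus> \<one>)"
    and ?B = "mat2 \<zero> (\<ominus> \<one>) (\<ominus> \<one>) \<one>" and ?B' = "mat2 (\<ominus> \<one>) (\<ominus> \<one>) (\<ominus> \<one>) \<zero>"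
  have "?A \<otimes>\<^bsub>?M\<^esub> ?A' = \<one>\<^bsub>?M\<^esub>" "?A' \<otimes>\<^bsub>?M\<^esub> ?A = \<one>\<^bsub>?M\<^esub>"
    "?B \<otimes>\<^bsub>?M\<^esub> ?B' = \<one>\<^bsub>?M\<^esub>" "?B' \<otimes>\<^bsub>?M\<^esub> ?B = \<one>\<^bsub>?M\<^esub>"
    by (simp_all add: mat2_mult mat2_one l_minus r_minus r_neg l_neg)
  then show "?A \<in> Units ?M" "?B \<in> Units ?M"
    unfolding Units_def using mat2_carrier by (simp, meson a_inv_closed one_closed zero_closed)+
  show "?A \<oplus>\<^bsub>?M\<^esub> ?B = \<one>\<^bsub>?M\<^esub>" by (simp add: mat2_add mat2_one r_neg)
qed

end

section \<open>Corners isomorphic to a ring of two-by-two matrices\<close>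

lemma (in ring) corner_matrix_ring_2_Units:
  assumes e: "e \<in> ring_idempotents R"
    and S: "ring S" "\<one>\<^bsub>S\<^esub> \<noteq> \<zero>\<^bsub>S\<^esub>"
    and iso: "corner_ring R e \<simeq> matrix_ring 2 S"
  shows "e \<noteq> \<zero>"
    and "\<exists>u1 \<in> Units (corner_ring R e). \<exists>u2 \<in> Units (corner_ring R e). u1 \<oplus> u2 = e"
proof -
  let ?C = "corner_ring R e" and ?M = "matrix_ring 2 S"
  interpret S: ring S by fact
  have ec: "e \<in> carrier R" "e \<otimes> e = e" using e by (auto simp: ring_idempotents_def)
  note C' = corner_ring_carrierD[OF e]
  obtain h where h: "h \<in> ring_hom ?C ?M" "bij_betw h (carrier ?C) (carrier ?M)"
    using iso by (auto simp: is_ring_iso_def ring_iso_def)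
  have inj: "x = y" if "h x = h y" "x \<in> carrier ?C" "y \<in> carrier ?C" for x y
    using that h(2) by (meson bij_betw_imp_inj_on inj_onD)
  have surj: "\<exists>x \<in> carrier ?C. h x = y" if "y \<in> carrier ?M" for y
    using that h(2) by (metis bij_betw_imp_surj_on imageE)
  have eC: "e \<in> carrier ?C" using ec by (intro corner_ring_carrierI)
  have mC: "x \<otimes> y \<in> carrier ?C" if xy: "x \<in> carrier ?C" "y \<in> carrier ?C" for x y
  proof (rule corner_ring_carrierI)
    show "x \<otimes> y \<in> carrier R" using xy C' by blast
    show "e \<otimes> (x \<otimes> y) = x \<otimes> y" using C'[OF xy(1)] C'[OF xy(2)] ec m_assoc by metis
    show "x \<otimes> y \<otimes> e = x \<otimes> y" using C'[OF xy(1)] C'[OF xy(2)] ec m_assoc by metis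
  qed
  have aC: "x \<oplus> y \<in> carrier ?C" if xy: "x \<in> carrier ?C" "y \<in> carrier ?C" for x y
    using C'[OF xy(1)] C'[OF xy(2)] ec by (intro corner_ring_carrierI) (auto simp: r_distr l_distr)
  have hm: "h (x \<otimes> y) = h x \<otimes>\<^bsub>?M\<^esub> h y" and ha: "h (x \<oplus> y) = h x \<oplus>\<^bsub>?M\<^esub> h y"
    if "x \<in> carrier ?C" "y \<in> carrier ?C" for x y
    using that ring_hom_mult[OF h(1)] ring_hom_add[OF h(1)] by auto
  have h1: "h e = \<one>\<^bsub>?M\<^esub>" using ring_hom_one[OF h(1)] by simp
  \<comment> \<open>Preimages of \<open>A\<close> and of its inverse are inverse to each other,
    because \<open>h\<close> is injective and sends both their products and \<open>e\<close> to the
    identity matrix.\<close>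
  have lift: "\<exists>u \<in> Units ?C. h u = A" if A: "A \<in> Units ?M" for A
  proof -
    obtain B where B: "A \<in> carrier ?M" "B \<in> carrier ?M" "B \<otimes>\<^bsub>?M\<^esub> A = \<one>\<^bsub>?M\<^esub>" "A \<otimes>\<^bsub>?M\<^esub> B = \<one>\<^bsub>?M\<^esub>"
      using A by (auto simp: Units_def)
    obtain u v where uv: "u \<in> carrier ?C" "h u = A" "v \<in> carrier ?C" "h v = B"
      using surj B by meson
    have "u \<otimes> v = e" "v \<otimes> u = e"
      using uv B by (auto intro!: inj mC eC simp: hm h1)
    then have "u \<in> Units ?C" using uv by (auto simp: Units_def)
    then show ?thesis using uv by blast
  qed
  show "\<exists>u1 \<in> Units ?C. \<exists>u2 \<in> Units ?C. u1 \<oplus> u2 = e"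
  proof -
    obtain A B where AB: "A \<in> Units ?M" "B \<in> Units ?M" "A \<oplus>\<^bsub>?M\<^esub> B = \<one>\<^bsub>?M\<^esub>"
      by (rule S.matrix_ring_2_one_sum_of_Units)
    obtain u1 u2 where u: "u1 \<in> Units ?C" "h u1 = A" "u2 \<in> Units ?C" "h u2 = B"
      using lift AB by meson
    then have "u1 \<in> carrier ?C" "u2 \<in> carrier ?C" by (auto simp: Units_def)
    then have "u1 \<oplus> u2 = e" using u AB by (auto intro!: inj aC eC simp: ha h1)
    then show ?thesis using u by blast
  qed
  show "e \<noteq> \<zero>"
  proof
    \<comment> \<open>The corner at 0 has a single element, whereas the identity and zero matrices
      differ when 1 \<noteq> 0 in \<open>S\<close>.\<close>
    assume "e = \<zero>"
    then have "x = \<zero>" if "x \<in> carrier ?C" for x using C'[OF that] by (metis l_null)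
    moreover obtain x y where "x \<in> carrier ?C" "h x = mat2 \<one>\<^bsub>S\<^esub> \<zero>\<^bsub>S\<^esub> \<zero>\<^bsub>S\<^esub> \<one>\<^bsub>S\<^esub>"
      "y \<in> carrier ?C" "h y = mat2 \<zero>\<^bsub>S\<^esub> \<zero>\<^bsub>S\<^esub> \<zero>\<^bsub>S\<^esub> \<zero>\<^bsub>S\<^esub>"
      using surj S.mat2_carrier by (meson S.one_closed S.zero_closed)
    ultimately have "mat2 \<one>\<^bsub>S\<^esub> \<zero>\<^bsub>S\<^esub> \<zero>\<^bsub>S\<^esub> \<one>\<^bsub>S\<^esub> = mat2 \<zero>\<^bsub>S\<^esub> \<zero>\<^bsub>S\<^esub> \<zero>\<^bsub>S\<^esub> \<zero>\<^bsub>S\<^esub>" by metis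
    then show False using S(2) mat2_apply(1) by metis
  qed
qed

text \<open>The degenerate cases are excluded because they are genuine exceptions: 0 is a unit of
  the corner at 0 and 0 + 0 = 0, while the matrices over the zero ring form a zero ring, isomorphic
  to that corner.\<close>

theorem proposition2p14:
  fixes R :: "('a, 'm) ring_scheme"
  assumes "ring R" and "potent_ring R" and "UJ_sharp_ring R"
  shows "(\<forall>e \<in> ring_idempotents (jacobson_quotient R). e \<noteq> \<zero>\<^bsub>jacobson_quotient R\<^esub> \<longrightarrow>
            (\<forall>u1 \<in> Units (corner_ring (jacobson_quotient R) e).
             \<forall>u2 \<in> Units (corner_ring (jacobson_quotient R) e).
               u1 \<oplus>\<^bsub>jacobson_quotient R\<^esub> u2 \<noteq> e)) \<and>
         \<not> (\<exists>e \<in> ring_idempotents (jacobson_quotient R). \<exists>S :: ('b, 'n) ring_scheme.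
               ring S \<and> \<one>\<^bsub>S\<^esub> \<noteq> \<zero>\<^bsub>S\<^esub> \<and>
               corner_ring (jacobson_quotient R) e \<simeq> matrix_ring 2 S)"
proof -
  interpret Q: ring "jacobson_quotient R"
    using ideal.quotient_is_ring[OF ring.ideal_jacobson_radical[OF assms(1)]] .
  note sum = Q.corner_Units_sum_idempotent[OF ring.UJ_sharp_quotient_Units[OF assms(1,3)]]
  \<comment> \<open>The fact \<open>sum\<close> forces \<open>e\<close> to be zero, which is the
    first item by contraposition. For the second, a matrix corner would supply a nonzero
    \<open>e\<close> that is a sum of two corner units.\<close>
  show ?thesis using sum Q.corner_matrix_ring_2_Units by metis
qed

end
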